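(* Let $1\le n\le m$ be integers and let $D=\binom{m+1}{2}-1$. Identify $\mathbb{R}^D$ with the Euclidean space of real symmetric $m\times m$ matrices of trace $0$, equipped with the norm $\|\cdot\|$. For $P\in G(m,n)$ let $\mathcal{P}$ be the matrix of the orthogonal projection of $\mathbb{R}^m$ onto $P$ and let $\bar{\mathcal{P}}=\mathcal{P}-\frac{n}{m}I_m$. Then the map $P\mapsto\bar{\mathcal{P}}$ gives an isometric embedding (up to the constant scale factor $\frac{1}{\sqrt2}$) of $G(m,n)$, with the chordal distance $d_c$, into the sphere of radius $\sqrt{n(m-n)/m}$ centered at the origin in $\mathbb{R}^D$; that is, $\bar{\mathcal{P}}\in\mathbb{R}^D$ and $\|\bar{\mathcal{P}}\|=\sqrt{n(m-n)/m}$ for every $P\in G(m,n)$, and for all $P,Q\in G(m,n)$, with projection matrices $\mathcal{P},\mathcal{Q}$, $$d_c(P,Q)=\frac{1}{\sqrt2}\,\|\mathcal{P}-\mathcal{Q}\|=\frac{1}{\sqrt2}\,\|\bar{\mathcal{P}}-\bar{\mathcal{Q}}\|.$$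
   Context: $G(m,n)$ denotes the set of all $n$-dimensional linear subspaces ("$n$-planes") of $\mathbb{R}^m$. Principal angles: for $P,Q\in G(m,n)$ the principal angles $\theta_1,\dots,\theta_n\in[0,\pi/2]$ are defined recursively by $\cos\theta_i=\max_{u\in P}\max_{v\in Q}u\cdot v=u_i\cdot v_i$ for $i=1,\dots,n$, the maximum being subject to $u\cdot u=v\cdot v=1$, $u\cdot u_j=0$, $v\cdot v_j=0$ for $1\le j\le i-1$. Chordal distance: $d_c(P,Q)=\sqrt{\sin^2\theta_1+\cdots+\sin^2\theta_n}$. Projection matrix: if $A$ is an $n\times m$ matrix whose rows form an orthonormal basis of $P$, then the matrix of the orthogonal projection onto $P$ is $\mathcal{P}=A^{tr}A$; it is symmetric, idempotent, of trace $n$, and independent of the choice of $A$. Norm: for a real $m\times m$ matrix $M=(M_{ij})$, $\|M\|=\sqrt{\sum_{i,j}M_{ij}^2}=\sqrt{\mathrm{trace}\,M^{tr}M}$. $I_m$ is the $m\times m$ identity matrix. *)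

theory Defs
  imports "HOL-Analysis.Analysis"
begin

definition grassmannian :: "nat \<Rightarrow> (real^'m) set set" where
  "grassmannian n = {P. subspace P \<and> dim P = n}"

definition admissible :: "(real^'m) set \<Rightarrow> (nat \<Rightarrow> real^'m) \<Rightarrow> nat \<Rightarrow> (real^'m) set" where
  "admissible P u i = {x \<in> P. x \<bullet> x = 1 \<and> (\<forall>j\<in>{1..<i}. x \<bullet> u j = 0)}"

text \<open>
  The maximising vectors are not unique, so the recursion is a relation: \<open>\<theta> 1, \<dots>, \<theta> n\<close> are
  the angles obtained from some successive choice \<open>u 1, v 1, \<dots>, u n, v n\<close> of maximisers.
  Values at indices outside \<open>{1..n}\<close> are unconstrained.
\<close>

definition principal_angles ::
  "nat \<Rightarrow> (real^'m) set \<Rightarrow> (real^'m) set \<Rightarrow> (nat \<Rightarrow> real) \<Rightarrow> bool" where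
  "principal_angles n P Q \<theta> \<longleftrightarrow>
     (\<exists>u v. \<forall>i\<in>{1..n}.
        \<theta> i \<in> {0..pi/2} \<and>
        u i \<in> admissible P u i \<and> v i \<in> admissible Q v i \<and>
        cos (\<theta> i) = u i \<bullet> v i \<and>
        (\<forall>x\<in>admissible P u i. \<forall>y\<in>admissible Q v i. x \<bullet> y \<le> u i \<bullet> v i))"

text \<open>
  The definite description expresses that the value does not depend on the choice of
  maximisers; any equation about \<open>chordal_dist\<close> on \<open>grassmannian n\<close> has to establish this.
\<close>

definition chordal_dist :: "nat \<Rightarrow> (real^'m) set \<Rightarrow> (real^'m) set \<Rightarrow> real" where
  "chordal_dist n P Q =
     (THE d. \<exists>\<theta>. principal_angles n P Q \<theta> \<and> d = sqrt (\<Sum>i=1..n. (sin (\<theta> i))\<^sup>2))"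

definition orth_proj :: "(real^'m) set \<Rightarrow> real^'m \<Rightarrow> real^'m" where
  "orth_proj P x = (THE y. y \<in> P \<and> (\<forall>z\<in>P. orthogonal (x - y) z))"

definition projection_matrix :: "(real^'m) set \<Rightarrow> real^'m^'m" where
  "projection_matrix P = matrix (orth_proj P)"

definition centered_projection :: "nat \<Rightarrow> (real^'m) set \<Rightarrow> real^'m^'m" where
  "centered_projection n P =
     projection_matrix P - (real n / real CARD('m)) *\<^sub>R mat 1"

definition traceless_symmetric :: "(real^'m^'m) set" where
  "traceless_symmetric = {M. transpose M = M \<and> trace M = 0}"

lemma projection_matrix_eq:
  fixes A :: "real^'m^'n"
  assumes orthonormal: "A ** transpose A = mat 1" and span: "span (rows A) = P"
  shows "projection_matrix P = transpose A ** A"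
proof -
  have "orth_proj P x = (transpose A ** A) *v x" for x
    unfolding orth_proj_def
  proof (rule the_equality, intro conjI ballI)
    let ?y = "(transpose A ** A) *v x"
    have "?y = (\<Sum>i\<in>UNIV. (A *v x) $ i *s column i (transpose A))"
      by (simp only: matrix_vector_mul_assoc [symmetric] matrix_mult_sum [of "transpose A"])
    also have "\<dots> \<in> span (rows A)"
      unfolding column_transpose scalar_mult_eq_scaleR
      by (intro span_sum span_scale span_base) (auto simp: rows_def)
    finally show mem: "?y \<in> P" using span by simp
    have "A *v ?y = A *v x"
      by (simp only: matrix_vector_mul_assoc matrix_mul_assoc orthonormal matrix_mul_lid)
    then have "A *v (x - ?y) = 0"
      by (simp add: matrix_vector_mult_diff_distrib)
    then have "row i A \<bullet> (x - ?y) = 0" for i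
      unfolding row_def vec_lambda_eta matrix_vector_mul_component [symmetric] by simp
    then have "orthogonal (x - ?y) r" if "r \<in> rows A" for r
      using that by (auto simp: rows_def orthogonal_def inner_commute)
    then show orth: "orthogonal (x - ?y) z" if "z \<in> P" for z
      using that span orthogonal_to_span [of z "rows A" "x - ?y"] by simp
    fix y assume y: "y \<in> P \<and> (\<forall>z\<in>P. orthogonal (x - y) z)"
    have "y - ?y \<in> P" using y mem span span_diff [of y "rows A" ?y] by simp
    then have "orthogonal (x - y) (y - ?y)" "orthogonal (x - ?y) (y - ?y)"
      using y orth by auto
    then have "(y - ?y) \<bullet> (y - ?y) = 0"
      by (simp add: orthogonal_def inner_diff_left inner_diff_right)
    then show "y = ?y" by simp
  qed
  then have "orth_proj P = (*v) (transpose A ** A)" by blast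
  then show ?thesis by (simp add: projection_matrix_def)
qed

text \<open>The library norm on \<open>real^'m^'m\<close> is the Frobenius norm, not the operator norm.\<close>

lemma norm_matrix_eq:
  fixes M :: "real^'m^'m"
  shows "norm M = sqrt (\<Sum>i\<in>UNIV. \<Sum>j\<in>UNIV. (M $ i $ j)\<^sup>2)"
    and "norm M = sqrt (trace (transpose M ** M))"
proof -
  show 1: "norm M = sqrt (\<Sum>i\<in>UNIV. \<Sum>j\<in>UNIV. (M $ i $ j)\<^sup>2)"
    by (simp add: norm_vec_def L2_set_def sum_nonneg)
  have "trace (transpose M ** M) = (\<Sum>j\<in>UNIV. \<Sum>i\<in>UNIV. (M $ i $ j)\<^sup>2)"
    by (simp add: trace_def matrix_matrix_mult_def transpose_def power2_eq_square)
  then show "norm M = sqrt (trace (transpose M ** M))"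
    unfolding 1 by (subst sum.swap) simp
qed

end

theory Submission
  imports Defs
begin

text \<open>
  With respect to the Frobenius inner product, the projection matrix of a subspace with
  orthonormal basis \<open>u\<close> is the sum of the matrices \<open>u i (u i)\<^sup>T\<close>, so that
  \<open>\<P> \<bullet> \<Q> = (\<Sum>i j. (u i \<bullet> v j)\<^sup>2)\<close>. Principal vectors are biorthogonal
  (\<open>u i \<bullet> v j = 0\<close> for \<open>i \<noteq> j\<close>): otherwise rotating \<open>v i\<close> towards \<open>v j\<close>, or \<open>u j\<close> towards \<open>u i\<close>,
  would increase a maximal inner product. Hence
  \<open>\<P> \<bullet> \<Q> = (\<Sum>i. (cos (\<theta> i))\<^sup>2)\<close>, whatever maximisers are chosen, and
  \<open>(norm (\<P> - \<Q>))\<^sup>2 = 2 * n - 2 * (\<P> \<bullet> \<Q>)\<close> is twice the squared chordal distance.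
\<close>

section \<open>Symmetric matrices\<close>

text \<open>For \<open>A = {i}\<close> this is \<open>E i i\<close>, for \<open>A = {i, j}\<close> it is \<open>E i j + E j i\<close>.\<close>

definition sym_unit :: "'m set \<Rightarrow> real^'m^'m" where
  "sym_unit A = (\<chi> i j. if {i, j} = A then 1 else 0)"

text \<open>Since \<open>{i, i}\<close> collapses to a singleton, this set indexes the diagonal and
  the off-diagonal symmetric units at once.\<close>

definition unordered_pairs :: "'m set set" where
  "unordered_pairs = range (\<lambda>(i, j). {i, j})"

text \<open>The members are the subsets with one or two elements; their numbers
  \<open>m choose 1\<close> and \<open>m choose 2\<close> add up by Pascal's rule.\<close>

lemma card_unordered_pairs:
  "card (unordered_pairs :: 'm::finite set set) = (CARD('m) + 1) choose 2"
proof -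
  have eq: "(unordered_pairs :: 'm set set) = {A. card A = 1} \<union> {A. card A = 2}"
  proof (intro set_eqI iffI)
    fix A :: "'m set"
    assume "A \<in> unordered_pairs"
    then show "A \<in> {A. card A = 1} \<union> {A. card A = 2}"
      by (auto simp: unordered_pairs_def card_insert_if split: if_splits)
  next
    fix A :: "'m set"
    assume "A \<in> {A. card A = 1} \<union> {A. card A = 2}"
    then consider i where "A = {i, i}" | i j where "A = {i, j}"
      by (auto simp: card_1_singleton_iff card_2_iff)
    then show "A \<in> unordered_pairs"
      unfolding unordered_pairs_def by cases auto
  qed
  have "card {A :: 'm set. card A = k} = CARD('m) choose k" for k
    using n_subsets [of "UNIV :: 'm set" k] by simp
  moreover have "card (unordered_pairs :: 'm set set)
      = card {A :: 'm set. card A = 1} + card {A :: 'm set. card A = 2}"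
    unfolding eq by (rule card_Un_disjoint) auto
  ultimately show ?thesis
    by (simp add: numeral_2_eq_2)
qed

lemma inner_matrix_eq_sum:
  fixes M N :: "real^'m^'m"
  shows "M \<bullet> N = (\<Sum>i\<in>UNIV. \<Sum>j\<in>UNIV. M $ i $ j * N $ i $ j)"
  by (simp add: inner_vec_def)

text \<open>Turns the condition of trace zero into orthogonality to the identity matrix.\<close>

lemma inner_mat_1: "mat 1 \<bullet> (M :: real^'m^'m) = trace M"
  by (simp add: inner_matrix_eq_sum trace_def mat_def if_distrib [of "\<lambda>x. x * _"] cong: if_cong)

lemma subspace_symmetric: "subspace {M :: real^'m^'m. transpose M = M}"
  by (auto simp: subspace_def transpose_def vec_eq_iff)

text \<open>Distinct symmetric units have disjoint supports, so they are orthogonal and hence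
  independent. They also span, the coefficient of a unit being the common entry of the matrix on its
  support.\<close>

lemma dim_symmetric: "dim {M :: real^'m^'m. transpose M = M} = (CARD('m) + 1) choose 2"
proof -
  let ?B = "sym_unit ` (unordered_pairs :: 'm set set)"
  have nonzero: "sym_unit A \<noteq> 0" if "A \<in> unordered_pairs" for A :: "'m set"
    using that by (auto simp: unordered_pairs_def sym_unit_def vec_eq_iff)
  have orth: "sym_unit A \<bullet> sym_unit B = 0" if "A \<noteq> B" for A B :: "'m set"
    using that by (intro trans [OF inner_matrix_eq_sum] sum.neutral ballI) (simp add: sym_unit_def)
  have inj: "inj_on sym_unit (unordered_pairs :: 'm set set)"
    by (rule inj_onI) (metis orth nonzero inner_eq_zero_iff)
  have indep: "independent ?B"
    by (rule pairwise_orthogonal_independent)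
      (use nonzero orth in \<open>auto simp: pairwise_def orthogonal_def, metis\<close>)
  have sub: "?B \<subseteq> {M. transpose M = M}"
    by (auto simp: sym_unit_def transpose_def vec_eq_iff insert_commute)
  have "{M :: real^'m^'m. transpose M = M} \<subseteq> span ?B"
  proof
    fix M :: "real^'m^'m"
    assume "M \<in> {M. transpose M = M}"
    then have sym: "M $ i $ j = M $ j $ i" for i j
      by (auto simp: transpose_def vec_eq_iff)
    \<comment> \<open>The set \<open>A\<close> does not order its two indices. By symmetry of
      \<open>M\<close> both orders give the same entry, so a suitable \<open>x\<close> exists for
      every unordered pair.\<close>
    define c where "c A = (SOME x. \<forall>i j. A = {i, j} \<longrightarrow> x = M $ i $ j)" for A
    have c: "c {k, l} = M $ k $ l" for k l
    proof -
      have "\<forall>i j. {k, l} = {i, j} \<longrightarrow> M $ k $ l = M $ i $ j"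
        using sym by (auto simp: doubleton_eq_iff)
      then have "\<forall>i j. {k, l} = {i, j} \<longrightarrow> c {k, l} = M $ i $ j"
        unfolding c_def by (rule someI)
      then show ?thesis by blast
    qed
    have "M = (\<Sum>A\<in>unordered_pairs. c A *\<^sub>R sym_unit A)"
    proof -
      have "(\<Sum>A\<in>unordered_pairs. c A *\<^sub>R sym_unit A) $ k $ l = M $ k $ l" for k l
      proof -
        have "{k, l} \<in> unordered_pairs" by (auto simp: unordered_pairs_def)
        then show ?thesis
          by (simp add: sym_unit_def c if_distrib [of "\<lambda>x. _ * x"] cong: if_cong)
      qed
      then show ?thesis by (simp add: vec_eq_iff)
    qed
    also have "\<dots> \<in> span ?B"
      by (intro span_sum span_scale span_base) auto
    finally show "M \<in> span ?B" .
  qed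
  then have "dim {M :: real^'m^'m. transpose M = M} = card ?B"
    using dim_unique [OF sub _ indep] by blast
  then show ?thesis
    using card_image [OF inj] card_unordered_pairs by simp
qed

lemma subspace_traceless_symmetric: "subspace (traceless_symmetric :: (real^'m^'m) set)"
  by (auto simp: subspace_def traceless_symmetric_def transpose_def vec_eq_iff trace_def
      sum.distrib simp flip: sum_distrib_left)

text \<open>Inside the symmetric matrices, the traceless ones form the orthogonal complement of the
  line through the identity, so exactly one dimension is lost.\<close>

lemma dim_traceless_symmetric:
  "dim (traceless_symmetric :: (real^'m^'m) set) = ((CARD('m) + 1) choose 2) - 1"
proof -
  let ?S = "{M :: real^'m^'m. transpose M = M}" and ?I = "mat 1 :: real^'m^'m"
  have "dim {y \<in> ?S. \<forall>x \<in> span {?I}. orthogonal x y} + dim (span {?I}) = dim ?S"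
    by (intro dim_subspace_orthogonal_to_vectors span_minimal subspace_symmetric)
      (auto simp: subspace_symmetric)
  moreover have "{y \<in> ?S. \<forall>x \<in> span {?I}. orthogonal x y} = traceless_symmetric"
    by (auto simp: traceless_symmetric_def orthogonal_def inner_mat_1 span_singleton)
  moreover have "?I \<noteq> 0"
    by (simp add: vec_eq_iff mat_def)
  ultimately show ?thesis
    by (simp add: dim_symmetric)
qed

section \<open>Projection matrices\<close>

text \<open>The indexed form serves both principal vectors, with index set \<open>{1..n}\<close>,
  and a basis given as a set \<open>B\<close>, indexed by itself through the identity
  function.\<close>

definition orthonormal_family :: "'i set \<Rightarrow> ('i \<Rightarrow> 'a::real_inner) \<Rightarrow> bool" where
  "orthonormal_family I u \<longleftrightarrow> (\<forall>i\<in>I. \<forall>j\<in>I. u i \<bullet> u j = (if i = j then 1 else 0))"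

lemma orthonormal_family_inj_on:
  assumes "orthonormal_family I u"
  shows "inj_on u I"
proof (rule inj_onI, rule ccontr)
  fix i j assume ij: "i \<in> I" "j \<in> I" and eq: "u i = u j" and "i \<noteq> j"
  have "u i \<bullet> u i = 1" "u i \<bullet> u j = 0"
    using assms ij \<open>i \<noteq> j\<close> unfolding orthonormal_family_def by simp_all
  with eq show False by simp
qed

lemma orthonormal_family_independent:
  fixes u :: "'i \<Rightarrow> 'a::euclidean_space"
  assumes "orthonormal_family I u"
  shows "independent (u ` I)"
proof (rule pairwise_orthogonal_independent)
  show "pairwise orthogonal (u ` I)"
    using assms by (auto simp: orthonormal_family_def pairwise_def orthogonal_def)
  show "0 \<notin> u ` I"
  proof
    assume "0 \<in> u ` I"
    then obtain i where i: "i \<in> I" "u i = 0" by auto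
    have "u i \<bullet> u i = 1"
      using assms \<open>i \<in> I\<close> by (simp add: orthonormal_family_def del: inner_eq_zero_iff)
    with i show False by simp
  qed
qed

lemma orthonormal_family_span:
  fixes u :: "'i \<Rightarrow> 'a::euclidean_space"
  assumes "orthonormal_family I u" "u ` I \<subseteq> P" "subspace P" "card I = dim P"
  shows "span (u ` I) = P"
proof -
  have "card (u ` I) = dim P"
    using card_image [OF orthonormal_family_inj_on [OF assms(1)]] assms(4) by simp
  then have "P \<subseteq> span (u ` I)"
    using card_ge_dim_independent [OF assms(2) orthonormal_family_independent [OF assms(1)]]
    by simp
  then show ?thesis
    using span_minimal [OF assms(2,3)] by blast
qed

text \<open>The remainder \<open>?y\<close> lies in the span and is orthogonal to it, hence
  orthogonal to itself.\<close>

lemma orthonormal_family_expansion: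
  fixes u :: "'i \<Rightarrow> 'a::euclidean_space"
  assumes u: "orthonormal_family I u" and fin: "finite I" and x: "x \<in> span (u ` I)"
  shows "(\<Sum>i\<in>I. (u i \<bullet> x) *\<^sub>R u i) = x"
proof -
  let ?y = "x - (\<Sum>i\<in>I. (u i \<bullet> x) *\<^sub>R u i)"
  have "u j \<bullet> (\<Sum>i\<in>I. (u i \<bullet> x) *\<^sub>R u i) = u j \<bullet> x" if "j \<in> I" for j
  proof -
    have "u j \<bullet> (\<Sum>i\<in>I. (u i \<bullet> x) *\<^sub>R u i) = (\<Sum>i\<in>I. if j = i then u i \<bullet> x else 0)"
      unfolding inner_sum_right
      using u that by (intro sum.cong) (auto simp: orthonormal_family_def)
    then show ?thesis using fin that by simp
  qed
  then have "u j \<bullet> ?y = 0" if "j \<in> I" for j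
    using that by (simp add: inner_diff_right)
  then have "orthogonal ?y z" if "z \<in> span (u ` I)" for z
    using that by (intro orthogonal_to_span [of z "u ` I"])
      (auto simp: orthogonal_def inner_commute [of ?y])
  moreover have "?y \<in> span (u ` I)"
    by (intro span_diff [OF x] span_sum span_scale span_base) auto
  ultimately show ?thesis
    by (metis orthogonal_self right_minus_eq)
qed

section \<open>Projection matrices as sums of outer products\<close>

definition rank_one :: "real^'m \<Rightarrow> real^'m^'m" where
  "rank_one v = (\<chi> i j. v $ i * v $ j)"

lemma inner_rank_one: "rank_one v \<bullet> rank_one w = (v \<bullet> w)\<^sup>2"
  by (simp add: inner_matrix_eq_sum rank_one_def inner_vec_def power2_eq_square sum_product
      mult_ac)

lemma trace_rank_one: "trace (rank_one v) = v \<bullet> v"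
  by (simp add: trace_def rank_one_def inner_vec_def)

lemma rank_one_vector_mult: "rank_one v *v x = (v \<bullet> x) *\<^sub>R v"
  by (simp add: matrix_vector_mult_def rank_one_def inner_vec_def vec_eq_iff sum_distrib_left
      mult_ac)

lemma sum_matrix_vector_mult:
  fixes M :: "'i \<Rightarrow> real^'n^'m"
  shows "(\<Sum>i\<in>I. M i) *v x = (\<Sum>i\<in>I. M i *v x)"
  by (induction I rule: infinite_finite_induct) (auto simp: matrix_vector_mult_add_rdistrib)

text \<open>The sum maps into \<open>P\<close> and leaves a residual orthogonal to each basis
  vector, which characterises the projection: two candidates differ by a vector of \<open>P\<close>
  orthogonal to itself. Unlike in \<open>projection_matrix_eq\<close>, the basis is indexed by a set
  rather than a type, so its size can be the number \<open>n\<close>.\<close>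

lemma projection_matrix_eq_sum:
  fixes P :: "(real^'m) set"
  assumes u: "orthonormal_family I u" "finite I" "u ` I \<subseteq> P"
    and P: "subspace P" "card I = dim P"
  shows "projection_matrix P = (\<Sum>i\<in>I. rank_one (u i))"
proof -
  note span = orthonormal_family_span [OF u(1,3) P]
  let ?M = "\<Sum>i\<in>I. rank_one (u i)"
  have M: "?M *v x = (\<Sum>i\<in>I. (u i \<bullet> x) *\<^sub>R u i)" for x
    by (simp add: sum_matrix_vector_mult rank_one_vector_mult)
  have "orth_proj P x = ?M *v x" for x
    unfolding orth_proj_def
  proof (rule the_equality, intro conjI ballI)
    show mem: "?M *v x \<in> P"
      unfolding M using u(3) P(1) by (auto intro!: subspace_sum subspace_scale)
    have "u j \<bullet> (?M *v x) = u j \<bullet> x" if "j \<in> I" for j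
    proof -
      have "u j \<bullet> (?M *v x) = (\<Sum>i\<in>I. if j = i then u i \<bullet> x else 0)"
        unfolding M inner_sum_right
        using u that by (intro sum.cong) (auto simp: orthonormal_family_def)
      then show ?thesis using u(2) that by simp
    qed
    then have "u j \<bullet> (x - ?M *v x) = 0" if "j \<in> I" for j
      using that by (simp add: inner_diff_right)
    then show orth: "orthogonal (x - ?M *v x) z" if "z \<in> P" for z
      using that span by (intro orthogonal_to_span [of z "u ` I"])
        (auto simp: orthogonal_def inner_commute [of "x - ?M *v x"])
    fix y assume y: "y \<in> P \<and> (\<forall>z\<in>P. orthogonal (x - y) z)"
    have "y - ?M *v x \<in> P"
      using y mem P(1) subspace_diff by blast
    then have "orthogonal (x - y) (y - ?M *v x)" "orthogonal (x - ?M *v x) (y - ?M *v x)"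
      using y orth by auto
    then have "(y - ?M *v x) \<bullet> (y - ?M *v x) = 0"
      by (simp add: orthogonal_def inner_diff_left inner_diff_right)
    then show "y = ?M *v x" by simp
  qed
  then have "orth_proj P = (*v) ?M" by blast
  then show ?thesis by (simp add: projection_matrix_def)
qed

lemma obtain_orthonormal_family:
  fixes P :: "(real^'m) set"
  assumes "subspace P"
  obtains B :: "(real^'m) set"
    where "orthonormal_family B (\<lambda>x. x)" "finite B" "B \<subseteq> P" "card B = dim P"
proof -
  obtain B where B: "B \<subseteq> P" "pairwise orthogonal B" "\<And>x. x \<in> B \<Longrightarrow> norm x = 1"
      "independent B" "card B = dim P"
    using orthonormal_basis_subspace [OF assms] by metis
  then have "orthonormal_family B (\<lambda>x. x)"
    by (auto simp: orthonormal_family_def pairwise_def orthogonal_def dot_square_norm)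
  then show thesis
    using that B independent_imp_finite by blast
qed

lemma transpose_projection_matrix:
  assumes "subspace P"
  shows "transpose (projection_matrix P) = projection_matrix P"
proof -
  obtain B where B: "orthonormal_family B (\<lambda>x. x)" "finite B" "B \<subseteq> P" "card B = dim P"
    using obtain_orthonormal_family [OF assms] .
  have eq: "projection_matrix P = (\<Sum>b\<in>B. rank_one b)"
    using projection_matrix_eq_sum [of B "\<lambda>x. x" P] B assms by simp
  show ?thesis
    unfolding eq by (simp add: vec_eq_iff transpose_def rank_one_def mult.commute)
qed

lemma trace_projection_matrix:
  assumes "subspace P"
  shows "trace (projection_matrix P) = dim P"
    and "projection_matrix P \<bullet> projection_matrix P = dim P"
proof -
  obtain B where B: "orthonormal_family B (\<lambda>x. x)" "finite B" "B \<subseteq> P" "card B = dim P"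
    using obtain_orthonormal_family [OF assms] .
  have eq: "projection_matrix P = (\<Sum>b\<in>B. rank_one b)"
    using projection_matrix_eq_sum [of B "\<lambda>x. x" P] B assms by simp
  have "trace (projection_matrix P) = (\<Sum>b\<in>B. mat 1 \<bullet> rank_one b)"
    unfolding eq inner_mat_1 [symmetric] inner_sum_right ..
  also have "\<dots> = (\<Sum>b\<in>B. 1)"
    using B(1) by (intro sum.cong) (auto simp: inner_mat_1 trace_rank_one orthonormal_family_def)
  finally show "trace (projection_matrix P) = dim P"
    using B by simp
  have "projection_matrix P \<bullet> projection_matrix P = (\<Sum>b\<in>B. \<Sum>c\<in>B. (b \<bullet> c)\<^sup>2)"
    unfolding eq inner_sum_left by (simp add: inner_sum_right inner_rank_one)
  \<comment> \<open>By orthonormality only the diagonal terms survive, one for each basis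
    vector.\<close>
  also have "\<dots> = (\<Sum>b\<in>B. \<Sum>c\<in>B. if b = c then 1 else 0)"
    using B(1) by (intro sum.cong) (auto simp: orthonormal_family_def)
  finally show "projection_matrix P \<bullet> projection_matrix P = dim P"
    using B by simp
qed

text \<open>Recovers the subspace as the fixed points of its projection matrix, which yields
  injectivity of \<open>projection_matrix\<close>.\<close>

lemma mem_iff_projection_matrix:
  assumes "subspace P"
  shows "x \<in> P \<longleftrightarrow> projection_matrix P *v x = x"
proof -
  obtain B where B: "orthonormal_family B (\<lambda>x. x)" "finite B" "B \<subseteq> P" "card B = dim P"
    using obtain_orthonormal_family [OF assms] .
  have span: "span B = P"
    using orthonormal_family_span [of B "\<lambda>x. x" P] B assms by simp
  have eq: "projection_matrix P *v x = (\<Sum>b\<in>B. (b \<bullet> x) *\<^sub>R b)"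
    using projection_matrix_eq_sum [of B "\<lambda>x. x" P] B assms
    by (simp add: sum_matrix_vector_mult rank_one_vector_mult)
  have "(\<Sum>b\<in>B. (b \<bullet> x) *\<^sub>R b) \<in> P"
    using B assms by (auto intro!: subspace_sum subspace_scale)
  moreover have "(\<Sum>b\<in>B. (b \<bullet> x) *\<^sub>R b) = x" if "x \<in> P"
    using orthonormal_family_expansion [of B "\<lambda>x. x" x] B span that by simp
  ultimately show ?thesis
    unfolding eq by metis
qed

lemma projection_matrix_inj_on: "inj_on projection_matrix {P. subspace P}"
proof (rule inj_onI)
  fix P Q :: "(real^'a) set"
  assume "P \<in> {P. subspace P}" "Q \<in> {P. subspace P}" "projection_matrix P = projection_matrix Q"
  then have "x \<in> P \<longleftrightarrow> x \<in> Q" for x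
    using mem_iff_projection_matrix by (metis mem_Collect_eq)
  then show "P = Q" by blast
qed

section \<open>Principal angles\<close>

text \<open>On the unit circle the linear form with coefficients \<open>a\<close> and
  \<open>b\<close> attains \<open>sqrt (a^2 + b^2)\<close> at the normalised vector
  \<open>(a / r, b / r)\<close>. This value exceeds \<open>a\<close> unless
  \<open>b = 0\<close>.\<close>

lemma zero_if_rotation_le:
  fixes a b :: real
  assumes "\<And>c s. c\<^sup>2 + s\<^sup>2 = 1 \<Longrightarrow> c * a + s * b \<le> a"
  shows "b = 0"
proof (rule ccontr)
  assume "b \<noteq> 0"
  define r where "r = sqrt (a\<^sup>2 + b\<^sup>2)"
  have r2: "r\<^sup>2 = a\<^sup>2 + b\<^sup>2" and "r \<noteq> 0"
    using \<open>b \<noteq> 0\<close> by (auto simp: r_def sum_power2_eq_zero_iff)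
  have "(a / r)\<^sup>2 + (b / r)\<^sup>2 = 1"
    using r2 \<open>r \<noteq> 0\<close> \<open>b \<noteq> 0\<close> by (simp add: power_divide flip: add_divide_distrib)
  then have "(a / r) * a + (b / r) * b \<le> a"
    by (rule assms)
  moreover have "(a / r) * a + (b / r) * b = r\<^sup>2 / r"
    unfolding r2 by (simp add: power2_eq_square add_divide_distrib)
  ultimately have "r \<le> a"
    using \<open>r \<noteq> 0\<close> by (simp add: power2_eq_square)
  moreover have "r > \<bar>a\<bar>"
    unfolding r_def using \<open>b \<noteq> 0\<close> by (intro real_less_rsqrt) simp
  ultimately show False by simp
qed

text \<open>Rotating within the plane of two orthogonal admissible vectors keeps the unit length and
  the linear constraints. This provides the competitors in the variational argument.\<close>

lemma admissible_combination:
  fixes x y :: "real^'m"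
  assumes "subspace P" "x \<in> admissible P u i" "y \<in> admissible P u i" "x \<bullet> y = 0"
    and "c\<^sup>2 + s\<^sup>2 = (1 :: real)"
  shows "c *\<^sub>R x + s *\<^sub>R y \<in> admissible P u i"
  using assms
  by (auto simp: admissible_def subspace_add subspace_scale inner_add_left inner_add_right
      inner_commute power2_eq_square)

lemma orthonormal_family_admissible:
  assumes "\<And>i. i \<in> {1..n} \<Longrightarrow> u i \<in> admissible P u i"
  shows "orthonormal_family {1..n} u"
  unfolding orthonormal_family_def
proof (intro ballI)
  fix i j assume "i \<in> {1..n}" "j \<in> {1..n}"
  then show "u i \<bullet> u j = (if i = j then 1 else 0)"
    using assms [of i] assms [of j]
    by (cases i j rule: linorder_cases) (auto simp: admissible_def inner_commute)
qed

lemma principal_vectors_orthogonal: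
  fixes P Q :: "(real^'m) set"
  assumes "subspace Q" "i < j" "1 \<le> i"
    and "u i \<in> admissible P u i" "v i \<in> admissible Q v i" "v j \<in> admissible Q v j"
    and max: "\<And>y. y \<in> admissible Q v i \<Longrightarrow> u i \<bullet> y \<le> u i \<bullet> v i"
  shows "u i \<bullet> v j = 0"
proof (rule zero_if_rotation_le)
  fix c s :: real
  assume "c\<^sup>2 + s\<^sup>2 = 1"
  \<comment> \<open>The constraints at the later stage \<open>j\<close> contain those at stage
    \<open>i\<close>, together with orthogonality to \<open>v i\<close> itself.\<close>
  moreover have "v j \<in> admissible Q v i" "v i \<bullet> v j = 0"
    using assms by (auto simp: admissible_def inner_commute)
  ultimately have "c *\<^sub>R v i + s *\<^sub>R v j \<in> admissible Q v i"
    using assms by (intro admissible_combination) auto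
  from max [OF this] show "c * (u i \<bullet> v i) + s * (u i \<bullet> v j) \<le> u i \<bullet> v i"
    by (simp add: inner_add_right)
qed

text \<open>The right-hand side does not mention \<theta>, so this also shows that the sum is
  independent of the chosen maximisers.\<close>

lemma principal_angles_sum_sin:
  fixes P Q :: "(real^'m) set"
  assumes P: "P \<in> grassmannian n" and Q: "Q \<in> grassmannian n"
    and \<theta>: "principal_angles n P Q \<theta>"
  shows "(\<Sum>i=1..n. (sin (\<theta> i))\<^sup>2) = n - projection_matrix P \<bullet> projection_matrix Q"
proof -
  have sub: "subspace P" "subspace Q" "dim P = n" "dim Q = n"
    using P Q by (auto simp: grassmannian_def)
  obtain u v where uv: "\<And>i. i \<in> {1..n} \<Longrightarrow>
        u i \<in> admissible P u i \<and> v i \<in> admissible Q v i \<and> cos (\<theta> i) = u i \<bullet> v i \<and>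
        (\<forall>x\<in>admissible P u i. \<forall>y\<in>admissible Q v i. x \<bullet> y \<le> u i \<bullet> v i)"
    using \<theta> unfolding principal_angles_def by blast
  have "orthonormal_family {1..n} u" "orthonormal_family {1..n} v"
    using uv by (blast intro: orthonormal_family_admissible)+
  moreover have "u ` {1..n} \<subseteq> P" "v ` {1..n} \<subseteq> Q"
    using uv by (auto simp: admissible_def)
  ultimately have proj: "projection_matrix P = (\<Sum>i=1..n. rank_one (u i))"
      "projection_matrix Q = (\<Sum>i=1..n. rank_one (v i))"
    using sub by (auto intro!: projection_matrix_eq_sum)
  have zero: "u i \<bullet> v j = 0" if "i \<in> {1..n}" "j \<in> {1..n}" "i \<noteq> j" for i j
  proof (cases "i < j")
    case True
    then show ?thesis
      using uv that sub by (intro principal_vectors_orthogonal [of Q i j u P v]) auto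
  next
    case False
    \<comment> \<open>Now \<open>j < i\<close>, so the argument runs at stage \<open>j\<close> with
      the roles of \<open>(P, u)\<close> and \<open>(Q, v)\<close> exchanged.\<close>
    then have "v j \<bullet> u i = 0"
      using uv that sub
      by (intro principal_vectors_orthogonal [of P j i v Q u]) (auto simp: inner_commute)
    then show ?thesis by (simp add: inner_commute)
  qed
  have "projection_matrix P \<bullet> projection_matrix Q = (\<Sum>i=1..n. \<Sum>j=1..n. (u i \<bullet> v j)\<^sup>2)"
    unfolding proj inner_sum_left by (simp add: inner_sum_right inner_rank_one)
  also have "\<dots> = (\<Sum>i=1..n. \<Sum>j=1..n. if i = j then (cos (\<theta> i))\<^sup>2 else 0)"
    using zero uv by (intro sum.cong) auto
  also have "\<dots> = (\<Sum>i=1..n. (cos (\<theta> i))\<^sup>2)"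
    by simp
  finally show ?thesis
    by (simp add: sin_squared_eq sum_subtractf)
qed

section \<open>Existence of principal angles\<close>

lemma admissible_nonempty:
  fixes P :: "(real^'m) set"
  assumes "subspace P" "i \<le> dim P" "1 \<le> i" "\<And>j. j \<in> {1..<i} \<Longrightarrow> u j \<in> P"
  shows "admissible P u i \<noteq> {}"
proof -
  let ?U = "u ` {1..<i}"
  let ?W = "{y \<in> P. \<forall>x \<in> span ?U. orthogonal x y}"
  \<comment> \<open>At most \<open>i - 1\<close> earlier vectors are to be avoided, fewer than the
    dimension of \<open>P\<close>. Their complement \<open>?W\<close> in \<open>P\<close> therefore
    has a nonzero vector, which is then normalised.\<close>
  have "dim ?W + dim (span ?U) = dim P"
    using assms by (intro dim_subspace_orthogonal_to_vectors span_minimal) auto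
  moreover have "dim (span ?U) \<le> i - 1"
    using dim_le_card' [of ?U] card_image_le [of "{1..<i}" u] by simp
  ultimately have "dim ?W \<noteq> 0"
    using assms by linarith
  then obtain y where y: "y \<in> ?W" "y \<noteq> 0"
    by (metis (no_types, lifting) dim_eq_0 singletonI subsetI)
  have "y \<bullet> u j = 0" if "j \<in> {1..<i}" for j
    using y that span_base [of "u j" ?U] by (auto simp: orthogonal_def inner_commute)
  then have "y /\<^sub>R norm y \<in> admissible P u i"
    using y assms by (auto simp: admissible_def subspace_scale dot_square_norm power2_eq_square)
  then show ?thesis by blast
qed

lemma compact_admissible:
  fixes P :: "(real^'m) set"
  assumes "subspace P"
  shows "compact (admissible P u i)"
proof -
  have "admissible P u i = sphere 0 1 \<inter> P \<inter> (\<Inter>j\<in>{1..<i}. {x. u j \<bullet> x = 0})"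
    by (auto simp: admissible_def norm_eq_1 inner_commute)
  then show ?thesis
    using assms
    by (auto simp: compact_Int_closed closed_subspace closed_hyperplane closed_INT)
qed

lemma admissible_maximiser:
  fixes P Q :: "(real^'m) set"
  assumes "subspace P" "subspace Q" "admissible P u i \<noteq> {}" "admissible Q v i \<noteq> {}"
  obtains a b where "a \<in> admissible P u i" "b \<in> admissible Q v i" "0 \<le> a \<bullet> b" "a \<bullet> b \<le> 1"
    "\<And>x y. x \<in> admissible P u i \<Longrightarrow> y \<in> admissible Q v i \<Longrightarrow> x \<bullet> y \<le> a \<bullet> b"
proof -
  let ?K = "admissible P u i \<times> admissible Q v i"
  have "compact ?K" "?K \<noteq> {}"
    using assms by (auto simp: compact_admissible intro!: compact_Times)
  moreover have "continuous_on ?K (\<lambda>p. fst p \<bullet> snd p)"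
    by (intro continuous_intros)
  ultimately obtain p where "p \<in> ?K" "\<forall>q\<in>?K. fst q \<bullet> snd q \<le> fst p \<bullet> snd p"
    using continuous_attains_sup [of ?K] by blast
  then obtain a b where ab: "a \<in> admissible P u i" "b \<in> admissible Q v i"
      and max: "\<And>x y. x \<in> admissible P u i \<Longrightarrow> y \<in> admissible Q v i \<Longrightarrow> x \<bullet> y \<le> a \<bullet> b"
    by (cases p) fastforce
  \<comment> \<open>The constraints are invariant under negation, so the maximum is at least its own
    negative. Together with the upper bound 1 this puts the later \<open>arccos\<close> into the
    interval from 0 to \<open>pi/2\<close>.\<close>
  have "- b \<in> admissible Q v i"
    using ab assms by (auto simp: admissible_def subspace_neg)
  from max [OF ab(1) this] have "0 \<le> a \<bullet> b"
    by simp
  moreover have "a \<bullet> b \<le> 1"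
    using norm_cauchy_schwarz [of a b] ab by (simp add: admissible_def norm_eq_sqrt_inner)
  ultimately show thesis
    using that ab max by blast
qed

lemma admissible_cong:
  "(\<And>j. j \<in> {1..<i} \<Longrightarrow> u j = u' j) \<Longrightarrow> admissible P u i = admissible P u' i"
  by (auto simp: admissible_def)

lemma principal_angles_exist:
  fixes P Q :: "(real^'m) set"
  assumes "subspace P" "subspace Q" "n \<le> dim P" "n \<le> dim Q"
  shows "\<exists>\<theta>. principal_angles n P Q \<theta>"
  using assms(3,4)
proof (induction n)
  case 0
  show ?case by (auto simp: principal_angles_def)
next
  case (Suc n)
  then obtain \<theta> where "principal_angles n P Q \<theta>"
    by auto
  then obtain u v where uv: "\<And>i. i \<in> {1..n} \<Longrightarrow>
        \<theta> i \<in> {0..pi/2} \<and>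
        u i \<in> admissible P u i \<and> v i \<in> admissible Q v i \<and>
        cos (\<theta> i) = u i \<bullet> v i \<and>
        (\<forall>x\<in>admissible P u i. \<forall>y\<in>admissible Q v i. x \<bullet> y \<le> u i \<bullet> v i)"
    unfolding principal_angles_def by blast
  have mem: "u i \<in> P" "v i \<in> Q" if "i \<in> {1..<Suc n}" for i
    using uv [of i] that by (auto simp: admissible_def)
  have "admissible P u (Suc n) \<noteq> {}"
    by (rule admissible_nonempty) (use mem(1) Suc.prems assms(1) in simp_all)
  moreover have "admissible Q v (Suc n) \<noteq> {}"
    by (rule admissible_nonempty) (use mem(2) Suc.prems assms(2) in simp_all)
  ultimately obtain a b where ab: "a \<in> admissible P u (Suc n)" "b \<in> admissible Q v (Suc n)"
      "0 \<le> a \<bullet> b" "a \<bullet> b \<le> 1"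
      "\<And>x y. x \<in> admissible P u (Suc n) \<Longrightarrow> y \<in> admissible Q v (Suc n) \<Longrightarrow> x \<bullet> y \<le> a \<bullet> b"
    by (rule admissible_maximiser [OF assms(1,2)]) (rule that)
  define u' where "u' = u(Suc n := a)"
  define v' where "v' = v(Suc n := b)"
  define \<theta>' where "\<theta>' = \<theta>(Suc n := arccos (a \<bullet> b))"
  \<comment> \<open>Stage \<open>i\<close> looks only at vectors with index below \<open>i\<close>.
    Overwriting index \<open>Suc n\<close> thus leaves all stages up to and including
    \<open>Suc n\<close> unchanged.\<close>
  have adm: "admissible P u' i = admissible P u i" "admissible Q v' i = admissible Q v i"
    if "i \<le> Suc n" for i
    using that by (auto intro!: admissible_cong simp: u'_def v'_def)
  have "\<theta>' i \<in> {0..pi/2} \<and>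
        u' i \<in> admissible P u' i \<and> v' i \<in> admissible Q v' i \<and>
        cos (\<theta>' i) = u' i \<bullet> v' i \<and>
        (\<forall>x\<in>admissible P u' i. \<forall>y\<in>admissible Q v' i. x \<bullet> y \<le> u' i \<bullet> v' i)"
    if "i \<in> {1..Suc n}" for i
  proof (cases "i = Suc n")
    case True
    then show ?thesis
      using ab arccos_le_pi2 [of "a \<bullet> b"] arccos_lbound [of "a \<bullet> b"] adm [of "Suc n"]
      by (simp add: u'_def v'_def \<theta>'_def)
  next
    case False
    then show ?thesis
      using uv [of i] that adm [of i] by (simp add: u'_def v'_def \<theta>'_def)
  qed
  then show ?case
    unfolding principal_angles_def by blast
qed

section \<open>Chordal distance and the centered embedding\<close>

lemma chordal_dist_eq_norm:
  fixes P Q :: "(real^'m) set"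
  assumes P: "P \<in> grassmannian n" and Q: "Q \<in> grassmannian n"
  shows "chordal_dist n P Q = 1 / sqrt 2 * norm (projection_matrix P - projection_matrix Q)"
proof -
  have sub: "subspace P" "subspace Q" "dim P = n" "dim Q = n"
    using P Q by (auto simp: grassmannian_def)
  let ?p = "projection_matrix P \<bullet> projection_matrix Q"
  obtain \<theta> where \<theta>: "principal_angles n P Q \<theta>"
    using principal_angles_exist [of P Q n] sub by auto
  \<comment> \<open>The definite description is resolved here: some system of principal angles
    exists, and every such system gives this same value.\<close>
  have "chordal_dist n P Q = sqrt (n - ?p)"
    unfolding chordal_dist_def
  proof (rule the_equality)
    show "\<exists>\<theta>. principal_angles n P Q \<theta> \<and> sqrt (n - ?p) = sqrt (\<Sum>i=1..n. (sin (\<theta> i))\<^sup>2)"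
      using \<theta> principal_angles_sum_sin [OF P Q \<theta>] by metis
  next
    fix d
    assume "\<exists>\<theta>. principal_angles n P Q \<theta> \<and> d = sqrt (\<Sum>i=1..n. (sin (\<theta> i))\<^sup>2)"
    then show "d = sqrt (n - ?p)"
      using principal_angles_sum_sin [OF P Q] by metis
  qed
  moreover have "(norm (projection_matrix P - projection_matrix Q))\<^sup>2 = 2 * (n - ?p)"
    using sub by (simp add: power2_norm_eq_inner inner_diff_left inner_diff_right
        trace_projection_matrix inner_commute)
  then have "norm (projection_matrix P - projection_matrix Q) = sqrt 2 * sqrt (n - ?p)"
    by (metis norm_ge_zero real_sqrt_mult real_sqrt_unique)
  ultimately show ?thesis by simp
qed

lemma centered_projection_mem:
  fixes P :: "(real^'m) set"
  assumes "P \<in> grassmannian n"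
  shows "centered_projection n P \<in> traceless_symmetric"
proof -
  have P: "subspace P" "dim P = n"
    using assms by (auto simp: grassmannian_def)
  have "transpose (centered_projection n P) = centered_projection n P"
    using transpose_projection_matrix [OF P(1)]
    by (auto simp: centered_projection_def transpose_def vec_eq_iff mat_def)
  \<comment> \<open>The projection has trace \<open>n\<close>, and the identity has trace
    \<open>CARD('m)\<close>, so the factor \<open>n / CARD('m)\<close> is exactly the one that
    cancels.\<close>
  moreover have "trace (centered_projection n P) = 0"
    using trace_projection_matrix(1) [OF P(1)] P(2)
    by (simp add: centered_projection_def inner_diff_right trace_I flip: inner_mat_1)
      (simp add: inner_mat_1 trace_I)
  ultimately show ?thesis
    by (simp add: traceless_symmetric_def)
qed

text \<open>With \<open>m = CARD('m)\<close>, expanding the square gives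
  \<open>n - 2 * n^2 / m + n^2 / m\<close>, because the inner products of projection and identity
  are both traces equal to \<open>n\<close>.\<close>

lemma norm_centered_projection:
  fixes P :: "(real^'m) set"
  assumes "P \<in> grassmannian n"
  shows "norm (centered_projection n P)
    = sqrt (real n * (real CARD('m) - real n) / real CARD('m))"
proof -
  have P: "subspace P" "dim P = n"
    using assms by (auto simp: grassmannian_def)
  let ?I = "mat 1 :: real^'m^'m"
  have "projection_matrix P \<bullet> ?I = n" "?I \<bullet> projection_matrix P = n" "?I \<bullet> ?I = CARD('m)"
    using trace_projection_matrix(1) [OF P(1)] P(2) inner_commute [of "projection_matrix P" ?I]
    by (simp_all add: inner_mat_1 trace_I)
  then have "centered_projection n P \<bullet> centered_projection n P
      = real n * (real CARD('m) - real n) / real CARD('m)"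
    using trace_projection_matrix(2) [OF P(1)] P(2)
    by (simp add: centered_projection_def inner_diff_left inner_diff_right field_simps)
  then show ?thesis
    by (simp add: norm_eq_sqrt_inner)
qed

text \<open>For fixed \<open>n\<close>, centering is a translation by a constant matrix, so
  injectivity passes over from \<open>projection_matrix\<close>.\<close>

lemma centered_projection_inj_on: "inj_on (centered_projection n) (grassmannian n)"
  using projection_matrix_inj_on
  by (auto simp: inj_on_def centered_projection_def grassmannian_def)

theorem theorem2:
  fixes n :: nat
  assumes "1 \<le> n" and "n \<le> CARD('m::finite)"
  shows
    "subspace (traceless_symmetric :: (real^'m^'m) set) \<and>
     dim (traceless_symmetric :: (real^'m^'m) set) = ((CARD('m) + 1) choose 2) - 1 \<and>
     (\<forall>P \<in> (grassmannian n :: (real^'m) set set).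
        centered_projection n P \<in> traceless_symmetric \<and>
        norm (centered_projection n P) =
          sqrt (real n * (real CARD('m) - real n) / real CARD('m))) \<and>
     inj_on (centered_projection n) (grassmannian n :: (real^'m) set set) \<and>
     (\<forall>P \<in> (grassmannian n :: (real^'m) set set). \<forall>Q \<in> grassmannian n.
        chordal_dist n P Q = 1 / sqrt 2 * norm (projection_matrix P - projection_matrix Q) \<and>
        chordal_dist n P Q =
          1 / sqrt 2 * norm (centered_projection n P - centered_projection n Q))"
proof (intro conjI ballI)
  fix P Q :: "(real^'m) set"
  assume P: "P \<in> grassmannian n" and Q: "Q \<in> grassmannian n"
  show "chordal_dist n P Q = 1 / sqrt 2 * norm (projection_matrix P - projection_matrix Q)"
    using P Q by (rule chordal_dist_eq_norm)
  then show "chordal_dist n P Q =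
      1 / sqrt 2 * norm (centered_projection n P - centered_projection n Q)"
    by (simp add: centered_projection_def)
qed (fact subspace_traceless_symmetric dim_traceless_symmetric centered_projection_inj_on
    | erule centered_projection_mem norm_centered_projection)+

end
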